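(* Let $(X,d)$ be a compact metric space and $f_{0,\infty}=\{f_n\}_{n=0}^{\infty}$ a sequence of continuous self-maps of $X$. Then the following are equivalent: $(X,f_{0,\infty})$ has $h$-shadowing; $(\mathcal K(X),\bar f_{0,\infty})$ has $h$-shadowing; $(\mathcal F^1(X),\tilde f_{0,\infty})$ has $h$-shadowing.
   Context: Induced systems: $\mathcal K(X)$ is the set of nonempty compact subsets of $X$ with the Hausdorff metric $D_X$; $\bar f_{0,\infty}=\{\bar f_n\}$, $\bar f_n(A)=f_n(A)$. For upper semicontinuous $u:X\to[0,1]$ let $[u]_\alpha=\{x:u(x)\ge\alpha\}$ for $\alpha\in(0,1]$ and $[u]_0=\overline{\{x:u(x)>0\}}$. $\mathcal F^1(X)$ is the set of upper semicontinuous $u:X\to[0,1]$ with $[u]_\alpha\in\mathcal K(X)$ for all $\alpha\in[0,1]$, with metric $d_\infty(u,v)=\sup_{\alpha\in(0,1]}D_X([u]_\alpha,[v]_\alpha)$. $\tilde f_{0,\infty}=\{\tilde f_n\}$ where $\tilde f_n(u)(x)=\sup_{z\in f_n^{-1}(x)}u(z)$ if $f_n^{-1}(x)\ne\emptyset$, and $0$ otherwise. $h$-shadowing, for a metric space $(Y,\rho)$ with a sequence of continuous self-maps $g_{0,\infty}=\{g_i\}_{i\ge0}$, $g_0^0=\mathrm{id}$, $g_0^n=g_{n-1}\circ\cdots\circ g_0$: a finite sequence $x_0,\dots,x_n$ in $Y$ is a finite $\delta$-pseudo orbit if $\rho(g_i(x_i),x_{i+1})<\delta$ for $0\le i\le n-1$.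 $(Y,g_{0,\infty})$ has $h$-shadowing if for every $\epsilon>0$ there is $\delta>0$ such that for every finite $\delta$-pseudo orbit $\{x_k\}_{k=0}^n$ there is $z\in Y$ with $\rho(g_0^k(z),x_k)<\epsilon$ for $0\le k\le n-1$ and $g_0^n(z)=x_n$. *)

theory Defs
  imports "HOL-Analysis.Analysis"
begin

text \<open>A dynamical system is given by a carrier set, a distance on it and a sequence of maps, so that
  the same notion of shadowing applies to a space and to its induced hyperspaces.\<close>

primrec orbit_map :: "(nat \<Rightarrow> 'b \<Rightarrow> 'b) \<Rightarrow> nat \<Rightarrow> 'b \<Rightarrow> 'b" where
  "orbit_map g 0 = id"
| "orbit_map g (Suc n) = g n \<circ> orbit_map g n"

text \<open>The finite sequence \<open>x 0, \<dots>, x n\<close> is encoded by the values of \<open>x\<close> on \<open>{..n}\<close>.\<close>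

definition finite_pseudo_orbit ::
  "'b set \<Rightarrow> ('b \<Rightarrow> 'b \<Rightarrow> real) \<Rightarrow> (nat \<Rightarrow> 'b \<Rightarrow> 'b) \<Rightarrow> real \<Rightarrow> nat \<Rightarrow> (nat \<Rightarrow> 'b) \<Rightarrow> bool" where
  "finite_pseudo_orbit Y \<rho> g \<delta> n x \<longleftrightarrow>
     (\<forall>i\<le>n. x i \<in> Y) \<and> (\<forall>i<n. \<rho> (g i (x i)) (x (Suc i)) < \<delta>)"

definition h_shadowing ::
  "'b set \<Rightarrow> ('b \<Rightarrow> 'b \<Rightarrow> real) \<Rightarrow> (nat \<Rightarrow> 'b \<Rightarrow> 'b) \<Rightarrow> bool" where
  "h_shadowing Y \<rho> g \<longleftrightarrow>
     (\<forall>\<epsilon>>0. \<exists>\<delta>>0. \<forall>n x. finite_pseudo_orbit Y \<rho> g \<delta> n x \<longrightarrow>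
        (\<exists>z\<in>Y. (\<forall>k<n. \<rho> (orbit_map g k z) (x k) < \<epsilon>) \<and> orbit_map g n z = x n))"

definition nonempty_compacts :: "'a::metric_space set set" where
  "nonempty_compacts = {A. A \<noteq> {} \<and> compact A}"

text \<open>The suprema below are real-valued: they are the intended ones for nonempty bounded sets.\<close>

definition hausdorff_dist :: "'a::metric_space set \<Rightarrow> 'a set \<Rightarrow> real" where
  "hausdorff_dist A B = max (SUP a\<in>A. infdist a B) (SUP b\<in>B. infdist b A)"

definition set_extension :: "('a \<Rightarrow> 'a) \<Rightarrow> 'a set \<Rightarrow> 'a set" where
  "set_extension f A = f ` A"

definition upper_semicontinuous :: "('a::topological_space \<Rightarrow> real) \<Rightarrow> bool" where
  "upper_semicontinuous u \<longleftrightarrow> (\<forall>x c. u x < c \<longrightarrow> (\<forall>\<^sub>F y in nhds x. u y < c))"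

definition level_set :: "('a::topological_space \<Rightarrow> real) \<Rightarrow> real \<Rightarrow> 'a set" where
  "level_set u \<alpha> = (if \<alpha> = 0 then closure {x. u x > 0} else {x. u x \<ge> \<alpha>})"

definition fuzzy_sets :: "('a::metric_space \<Rightarrow> real) set" where
  "fuzzy_sets = {u. range u \<subseteq> {0..1} \<and> upper_semicontinuous u \<and>
                    (\<forall>\<alpha>\<in>{0..1}. level_set u \<alpha> \<in> nonempty_compacts)}"

definition fuzzy_dist :: "('a::metric_space \<Rightarrow> real) \<Rightarrow> ('a \<Rightarrow> real) \<Rightarrow> real" where
  "fuzzy_dist u v = (SUP \<alpha>\<in>{0<..1}. hausdorff_dist (level_set u \<alpha>) (level_set v \<alpha>))"

definition zadeh_extension :: "('a \<Rightarrow> 'a) \<Rightarrow> ('a \<Rightarrow> real) \<Rightarrow> 'a \<Rightarrow> real" where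
  "zadeh_extension f u x = (if f -` {x} = {} then 0 else SUP z\<in>f -` {x}. u z)"

end

theory Submission
  imports Defs
begin

text \<open>Shadowing passes from points to compact sets level by level: given a pseudo orbit \<open>A 0, \<dots>, A n\<close>
  of compact sets, let \<open>Z\<close> consist of all \<open>z\<close> whose orbit stays within \<open>\<epsilon>\<close> of \<open>A k\<close> for \<open>k < n\<close> and
  lands in \<open>A n\<close>.  This set is closed, and since every point of every \<open>A k\<close> lies on a pseudo orbit
  of points running through \<open>A 0, \<dots>, A n\<close>, shadowing in the base space shows that \<open>Z\<close> shadows
  the given sets.  For fuzzy sets, the sets \<open>Z\<close> belonging to the \<open>\<alpha>\<close>-cuts are again the
  \<open>\<alpha>\<close>-cuts of a fuzzy set, because upper semicontinuous functions attain their maxima on compact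
  sets.  Conversely, points embed as singletons, respectively as indicators of singletons.\<close>

section \<open>Iterates of the maps and compactness of closed sets\<close>

lemma orbit_map_set_extension:
  "orbit_map (\<lambda>n. set_extension (f n)) k A = orbit_map f k ` A"
  by (induction k) (auto simp: set_extension_def)

lemma continuous_on_orbit_map:
  assumes "\<And>n. continuous_on UNIV (f n)"
  shows "continuous_on UNIV (orbit_map f k)"
proof (induction k)
  case (Suc k)
  then show ?case
    using assms by (auto simp: o_def intro: continuous_on_compose2)
qed (simp add: id_def)

lemma compact_if_closed:
  fixes S :: "'a::metric_space set"
  assumes "compact (UNIV :: 'a set)" and "closed S"
  shows "compact S"
  using compact_Int_closed[OF assms] by simp

subsection \<open>The Hausdorff distance\<close>

lemma infdist_less_iff:
  assumes "B \<noteq> {}"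
  shows "infdist x B < r \<longleftrightarrow> (\<exists>b\<in>B. dist x b < r)"
proof -
  have "bdd_below (dist x ` B)"
    by (intro bdd_belowI2[where m = 0]) simp
  then show ?thesis
    using assms by (simp add: infdist_notempty cINF_less_iff)
qed

text \<open>Compactness makes the infimum attained, so a nonstrict bound has a witness too. This
  turns the existential condition in \<open>shadowing_set\<close> into a closed one.\<close>

lemma infdist_le_iff_compact:
  assumes "compact B" and "B \<noteq> {}"
  shows "infdist x B \<le> r \<longleftrightarrow> (\<exists>b\<in>B. dist x b \<le> r)"
proof
  have "continuous_on B (dist x)"
    by (intro continuous_intros)
  then obtain b where b: "b \<in> B" "\<And>c. c \<in> B \<Longrightarrow> dist x b \<le> dist x c"
    using continuous_attains_inf[OF assms] by blast
  have "dist x b \<le> infdist x B"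
    using b assms by (auto simp: infdist_notempty intro: cINF_greatest)
  then show "\<exists>b\<in>B. dist x b \<le> r" if "infdist x B \<le> r"
    using b that by force
qed (blast intro: infdist_le2)

text \<open>A real-valued supremum dominates its terms only when they are bounded above. Here the
  distances to one fixed point of \<open>B\<close> provide the bound.\<close>

lemma bdd_above_infdist:
  fixes A B :: "'a::metric_space set"
  assumes "compact (UNIV :: 'a set)" and "B \<noteq> {}"
  shows "bdd_above ((\<lambda>a. infdist a B) ` A)"
proof -
  obtain b where "b \<in> B"
    using assms by blast
  moreover obtain e where "\<And>x. dist b x \<le> e"
    using compact_imp_bounded[OF assms(1)] unfolding bounded_any_center[where a = b] by auto
  ultimately show ?thesis
    by (intro bdd_aboveI2[where M = e]) (metis dist_commute infdist_le2)
qed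

lemma hausdorff_dist_lessD:
  fixes A B :: "'a::metric_space set"
  assumes "compact (UNIV :: 'a set)" and "A \<noteq> {}" "B \<noteq> {}" and "hausdorff_dist A B < r"
  shows "a \<in> A \<Longrightarrow> \<exists>b\<in>B. dist a b < r" and "b \<in> B \<Longrightarrow> \<exists>a\<in>A. dist a b < r"
proof -
  show "\<exists>b\<in>B. dist a b < r" if "a \<in> A"
    using cSUP_upper[OF that bdd_above_infdist[OF assms(1,3)]] assms
    by (simp add: hausdorff_dist_def flip: infdist_less_iff)
  have "infdist b A < r" if "b \<in> B"
    using cSUP_upper[OF that bdd_above_infdist[OF assms(1,2)]] assms
    by (simp add: hausdorff_dist_def)
  then show "\<exists>a\<in>A. dist a b < r" if "b \<in> B"
    using that assms by (simp add: infdist_less_iff dist_commute)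
qed

text \<open>Suprema preserve only nonstrict bounds, which is why the shadowing arguments for sets
  and fuzzy sets work with half of the given \<epsilon>.\<close>

lemma hausdorff_dist_leI:
  assumes "A \<noteq> {}" "B \<noteq> {}"
    and "\<And>a. a \<in> A \<Longrightarrow> \<exists>b\<in>B. dist a b \<le> r" and "\<And>b. b \<in> B \<Longrightarrow> \<exists>a\<in>A. dist a b \<le> r"
  shows "hausdorff_dist A B \<le> r"
proof -
  have "infdist a B \<le> r" if "a \<in> A" for a
    using assms(3)[OF that] infdist_le2 by blast
  moreover have "infdist b A \<le> r" if "b \<in> B" for b
    using assms(4)[OF that] infdist_le2 by (metis dist_commute)
  ultimately show ?thesis
    unfolding hausdorff_dist_def using assms(1,2) by (auto intro!: cSUP_least)
qed

lemma hausdorff_dist_singletons [simp]: "hausdorff_dist {x} {y} = dist x y"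
  by (simp add: hausdorff_dist_def dist_commute)

subsection \<open>Shadowing of compact sets\<close>

text \<open>Start at time \<open>k\<close> and extend both ways: \<open>bwd\<close> supplies
  approximate preimages down to time 0, \<open>fwd\<close> supplies successors up to time
  \<open>n\<close>. The two hypotheses are the two halves of a Hausdorff estimate.\<close>

lemma pseudo_orbit_through:
  fixes A :: "nat \<Rightarrow> 'a::metric_space set"
  assumes fwd: "\<And>i a. i < n \<Longrightarrow> a \<in> A i \<Longrightarrow> \<exists>b\<in>A (Suc i). dist (f i a) b < \<delta>"
    and bwd: "\<And>i b. i < n \<Longrightarrow> b \<in> A (Suc i) \<Longrightarrow> \<exists>a\<in>A i. dist (f i a) b < \<delta>"
    and "k \<le> n" and "a \<in> A k"
  obtains x where "x k = a" and "\<And>i. i \<le> n \<Longrightarrow> x i \<in> A i"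
    and "finite_pseudo_orbit UNIV dist f \<delta> n x"
proof -
  have backward: "\<exists>x. x k = a \<and> (\<forall>i\<le>k. x i \<in> A i) \<and> (\<forall>i<k. dist (f i (x i)) (x (Suc i)) < \<delta>)"
    using \<open>k \<le> n\<close> \<open>a \<in> A k\<close>
  \<comment> \<open>The endpoint must stay general: the induction hypothesis is applied to the
    approximate preimage \<open>b\<close> of \<open>a\<close>.\<close>
  proof (induction k arbitrary: a)
    case 0
    then show ?case by (intro exI[of _ "\<lambda>_. a"]) auto
  next
    case (Suc k)
    then obtain b where b: "b \<in> A k" "dist (f k b) a < \<delta>"
      using bwd[of k a] by auto
    with Suc obtain x where x: "x k = b" "\<forall>i\<le>k. x i \<in> A i"
      "\<forall>i<k. dist (f i (x i)) (x (Suc i)) < \<delta>"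
      by (metis Suc_leD)
    show ?case
      using b x Suc.prems by (intro exI[of _ "x(Suc k := a)"]) (auto simp: le_Suc_eq less_Suc_eq)
  qed
  \<comment> \<open>Successors are appended one at a time; since \<open>k \<le> m\<close>, changing
    the value at \<open>Suc m\<close> leaves \<open>x k\<close> intact.\<close>
  have "\<exists>x. x k = a \<and> (\<forall>i\<le>m. x i \<in> A i) \<and> (\<forall>i<m. dist (f i (x i)) (x (Suc i)) < \<delta>)"
    if "k \<le> m" "m \<le> n" for m
    using that
  proof (induction m rule: dec_induct)
    case base
    show ?case by (rule backward)
  next
    case (step m)
    then obtain x where x: "x k = a" "\<forall>i\<le>m. x i \<in> A i"
      "\<forall>i<m. dist (f i (x i)) (x (Suc i)) < \<delta>"
      by auto
    then obtain b where "b \<in> A (Suc m)" "dist (f m (x m)) b < \<delta>"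
      using fwd[of m "x m"] step by auto
    then show ?case
      using x step by (intro exI[of _ "x(Suc m := b)"]) (auto simp: le_Suc_eq less_Suc_eq)
  qed
  from this[of n] \<open>k \<le> n\<close> that show ?thesis
    by (auto simp: finite_pseudo_orbit_def)
qed

text \<open>The bound is nonstrict so that the set is closed, and time \<open>n\<close> is set apart
  because h-shadowing demands exact landing there.\<close>

definition shadowing_set ::
  "(nat \<Rightarrow> 'a::metric_space \<Rightarrow> 'a) \<Rightarrow> real \<Rightarrow> nat \<Rightarrow> (nat \<Rightarrow> 'a set) \<Rightarrow> 'a set" where
  "shadowing_set f \<epsilon> n A =
     {z. (\<forall>k<n. \<exists>y\<in>A k. dist (orbit_map f k z) y \<le> \<epsilon>) \<and> orbit_map f n z \<in> A n}"

text \<open>For compact \<open>A k\<close> the condition at time \<open>k\<close> describes a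
  sublevel set of a continuous function, and the landing condition is a preimage of a compact
  set.\<close>

lemma closed_shadowing_set:
  assumes cont: "\<And>n. continuous_on UNIV (f n)"
    and A: "\<And>k. k \<le> n \<Longrightarrow> compact (A k) \<and> A k \<noteq> {}"
  shows "closed (shadowing_set f \<epsilon> n A)"
proof -
  have "shadowing_set f \<epsilon> n A =
    (\<Inter>k\<in>{..<n}. {z. infdist (orbit_map f k z) (A k) \<le> \<epsilon>}) \<inter> orbit_map f n -` A n"
    using A by (auto simp: shadowing_set_def infdist_le_iff_compact)
  moreover have "closed {z. infdist (orbit_map f k z) (A k) \<le> \<epsilon>}" for k
    by (intro closed_Collect_le continuous_intros continuous_on_orbit_map cont)
  moreover have "closed (orbit_map f n -` A n)"
    using A[of n] by (intro closed_vimage compact_imp_closed continuous_on_orbit_map cont) auto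
  ultimately show ?thesis
    by (auto intro!: closed_Int closed_INT)
qed

text \<open>That orbits from \<open>Z\<close> stay near the \<open>A k\<close> and land in
  \<open>A n\<close> is built into \<open>Z\<close>. Conversely, a point of \<open>A k\<close> is
  reached by running a pseudo orbit through it and shadowing that pseudo orbit from a point of
  \<open>Z\<close>.\<close>

lemma shadowing_set_shadows:
  fixes f :: "nat \<Rightarrow> 'a::metric_space \<Rightarrow> 'a"
  assumes UNIV: "compact (UNIV :: 'a set)"
    and shadow: "\<And>n x. finite_pseudo_orbit UNIV dist f \<delta> n x \<Longrightarrow>
      \<exists>z. (\<forall>k<n. dist (orbit_map f k z) (x k) < \<epsilon>) \<and> orbit_map f n z = x n"
    and nonempty: "\<And>k. k \<le> n \<Longrightarrow> A k \<noteq> {}"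
    and pseudo: "\<And>i. i < n \<Longrightarrow> hausdorff_dist (f i ` A i) (A (Suc i)) < \<delta>"
  defines "Z \<equiv> shadowing_set f \<epsilon> n A"
  shows "Z \<noteq> {}"
    and "k < n \<Longrightarrow> hausdorff_dist (orbit_map f k ` Z) (A k) \<le> \<epsilon>"
    and "orbit_map f n ` Z = A n"
proof -
  have fwd: "\<exists>b\<in>A (Suc i). dist (f i a) b < \<delta>" if "i < n" "a \<in> A i" for i a
    using hausdorff_dist_lessD(1)[OF UNIV _ _ pseudo[OF that(1)]] nonempty[of i]
      nonempty[of "Suc i"] that by auto
  have bwd: "\<exists>a\<in>A i. dist (f i a) b < \<delta>" if "i < n" "b \<in> A (Suc i)" for i b
    using hausdorff_dist_lessD(2)[OF UNIV _ _ pseudo[OF that(1)]] nonempty[of i]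
      nonempty[of "Suc i"] that by auto
  \<comment> \<open>At \<open>k = n\<close> this gives both that \<open>Z\<close> is nonempty and
    that its image covers \<open>A n\<close>.\<close>
  have through: "\<exists>z\<in>Z. if k < n then dist (orbit_map f k z) a \<le> \<epsilon> else orbit_map f n z = a"
    if k: "k \<le> n" and a: "a \<in> A k" for k a
  proof -
    obtain x where x: "x k = a" "\<And>i. i \<le> n \<Longrightarrow> x i \<in> A i" "finite_pseudo_orbit UNIV dist f \<delta> n x"
      using pseudo_orbit_through[of n A f \<delta> k a] fwd bwd k a by blast
    obtain z where z: "\<forall>k<n. dist (orbit_map f k z) (x k) < \<epsilon>" "orbit_map f n z = x n"
      using shadow[OF x(3)] by blast
    have "z \<in> Z"
      unfolding Z_def shadowing_set_def using x(2) z by (auto intro!: bexI[of _ "x _"] less_imp_le)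
    then show ?thesis
      using x(1) z k by (intro bexI[of _ z]) (auto simp: less_imp_le le_less)
  qed
  show "Z \<noteq> {}"
    using through[of n] nonempty[of n] by auto
  then show "hausdorff_dist (orbit_map f k ` Z) (A k) \<le> \<epsilon>" if "k < n"
    using that nonempty[of k] through[of k]
    by (intro hausdorff_dist_leI) (auto simp: Z_def shadowing_set_def)
  show "orbit_map f n ` Z = A n"
    using through[of n] by (auto simp: Z_def shadowing_set_def)
qed

lemma h_shadowing_nonempty_compacts:
  fixes f :: "nat \<Rightarrow> 'a::metric_space \<Rightarrow> 'a"
  assumes UNIV: "compact (UNIV :: 'a set)" and cont: "\<And>n. continuous_on UNIV (f n)"
    and "h_shadowing UNIV dist f"
  shows "h_shadowing nonempty_compacts hausdorff_dist (\<lambda>n. set_extension (f n))"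
  unfolding h_shadowing_def orbit_map_set_extension
proof (intro allI impI)
  fix \<epsilon> :: real assume "\<epsilon> > 0"
  \<comment> \<open>Half of \<epsilon> leaves room to return from a nonstrict Hausdorff bound to a
    strict one.\<close>
  then obtain \<delta> where "\<delta> > 0" and shadow: "\<And>n x. finite_pseudo_orbit UNIV dist f \<delta> n x \<Longrightarrow>
      \<exists>z. (\<forall>k<n. dist (orbit_map f k z) (x k) < \<epsilon> / 2) \<and> orbit_map f n z = x n"
    using assms(3) unfolding h_shadowing_def by (metis half_gt_zero)
  have "\<exists>Z\<in>nonempty_compacts. (\<forall>k<n. hausdorff_dist (orbit_map f k ` Z) (A k) < \<epsilon>) \<and>
      orbit_map f n ` Z = A n"
    if po: "finite_pseudo_orbit nonempty_compacts hausdorff_dist (\<lambda>n. set_extension (f n)) \<delta> n A"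
    for n A
  proof -
    let ?Z = "shadowing_set f (\<epsilon> / 2) n A"
    have A: "compact (A k) \<and> A k \<noteq> {}" if "k \<le> n" for k
      using po that by (auto simp: finite_pseudo_orbit_def nonempty_compacts_def)
    have pseudo: "hausdorff_dist (f i ` A i) (A (Suc i)) < \<delta>" if "i < n" for i
      using po that by (auto simp: finite_pseudo_orbit_def set_extension_def)
    have "closed ?Z"
      using cont A by (rule closed_shadowing_set)
    then have "compact ?Z"
      by (rule compact_if_closed[OF UNIV])
    moreover have "?Z \<noteq> {}"
      "\<And>k. k < n \<Longrightarrow> hausdorff_dist (orbit_map f k ` ?Z) (A k) \<le> \<epsilon> / 2"
      "orbit_map f n ` ?Z = A n"
      using shadowing_set_shadows[OF UNIV shadow, where A = A and n = n] A pseudo by auto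
    ultimately show ?thesis
      using \<open>\<epsilon> > 0\<close> by (intro bexI[of _ ?Z]) (fastforce simp: nonempty_compacts_def)+
  qed
  with \<open>\<delta> > 0\<close> show "\<exists>\<delta>>0. \<forall>n A. finite_pseudo_orbit nonempty_compacts hausdorff_dist
      (\<lambda>n. set_extension (f n)) \<delta> n A \<longrightarrow>
      (\<exists>Z\<in>nonempty_compacts. (\<forall>k<n. hausdorff_dist (orbit_map f k ` Z) (A k) < \<epsilon>) \<and>
        orbit_map f n ` Z = A n)"
    by blast
qed

text \<open>Singletons turn a pseudo orbit of points into one of compact sets with the same errors.
  Closeness to a singleton controls every point of a set, so any point of the shadowing set
  \<open>Z\<close> serves.\<close>

lemma h_shadowing_if_nonempty_compacts:
  fixes f :: "nat \<Rightarrow> 'a::metric_space \<Rightarrow> 'a"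
  assumes UNIV: "compact (UNIV :: 'a set)"
    and "h_shadowing nonempty_compacts hausdorff_dist (\<lambda>n. set_extension (f n))"
  shows "h_shadowing UNIV dist f"
  unfolding h_shadowing_def
proof (intro allI impI)
  fix \<epsilon> :: real assume "\<epsilon> > 0"
  then obtain \<delta> where "\<delta> > 0" and shadow:
    "\<And>n A. finite_pseudo_orbit nonempty_compacts hausdorff_dist (\<lambda>n. set_extension (f n)) \<delta> n A \<Longrightarrow>
      \<exists>Z\<in>nonempty_compacts. (\<forall>k<n. hausdorff_dist (orbit_map f k ` Z) (A k) < \<epsilon>) \<and>
        orbit_map f n ` Z = A n"
    using assms(2) unfolding h_shadowing_def orbit_map_set_extension by metis
  have "\<exists>z\<in>UNIV. (\<forall>k<n. dist (orbit_map f k z) (x k) < \<epsilon>) \<and> orbit_map f n z = x n"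
    if po: "finite_pseudo_orbit UNIV dist f \<delta> n x" for n x
  proof -
    have "finite_pseudo_orbit nonempty_compacts hausdorff_dist (\<lambda>n. set_extension (f n)) \<delta> n
        (\<lambda>k. {x k})"
      using po by (auto simp: finite_pseudo_orbit_def nonempty_compacts_def set_extension_def)
    then obtain Z where Z: "Z \<in> nonempty_compacts"
      "\<And>k. k < n \<Longrightarrow> hausdorff_dist (orbit_map f k ` Z) {x k} < \<epsilon>" "orbit_map f n ` Z = {x n}"
      using shadow by blast
    then obtain z where z: "z \<in> Z"
      by (auto simp: nonempty_compacts_def)
    have "dist (orbit_map f k z) (x k) < \<epsilon>" if "k < n" for k
      using hausdorff_dist_lessD(1)[OF UNIV _ _ Z(2)[OF that]] z by auto
    then show ?thesis
      using z Z(3) by (intro bexI[of _ z]) auto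
  qed
  with \<open>\<delta> > 0\<close> show "\<exists>\<delta>>0. \<forall>n x. finite_pseudo_orbit UNIV dist f \<delta> n x \<longrightarrow>
      (\<exists>z\<in>UNIV. (\<forall>k<n. dist (orbit_map f k z) (x k) < \<epsilon>) \<and> orbit_map f n z = x n)"
    by blast
qed

subsection \<open>Fuzzy sets and their level sets\<close>

lemma upper_semicontinuous_iff_closed:
  "upper_semicontinuous u \<longleftrightarrow> (\<forall>c. closed {x. c \<le> u x})"
proof -
  have "closed {x. c \<le> u x} \<longleftrightarrow> (\<forall>x. u x < c \<longrightarrow> (\<forall>\<^sub>F y in nhds x. u y < c))" for c
  proof -
    have "- {x. c \<le> u x} = {x. u x < c}" by auto
    then show ?thesis
      by (simp add: closed_def open_subopen[of "{x. u x < c}"] eventually_nhds subset_eq)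
  qed
  then show ?thesis
    by (auto simp: upper_semicontinuous_def)
qed

text \<open>A maximiser is a common point of \<open>K\<close> and the closed sets
  \<open>{x. u y \<le> u x}\<close> for \<open>y\<close> in \<open>K\<close>. By compactness
  finitely many \<open>y\<close> suffice, and among those one with the largest value works.\<close>

lemma upper_semicontinuous_attains_max:
  fixes u :: "'a::topological_space \<Rightarrow> real"
  assumes usc: "upper_semicontinuous u" and K: "compact K" "K \<noteq> {}"
  obtains x where "x \<in> K" and "\<And>y. y \<in> K \<Longrightarrow> u y \<le> u x"
proof -
  have "K \<inter> (\<Inter>y\<in>K. {x. u y \<le> u x}) \<noteq> {}"
  proof (rule compact_imp_fip_image[OF K(1)])
    show "closed {x. u y \<le> u x}" for y
      using usc by (simp add: upper_semicontinuous_iff_closed)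
    fix F assume F: "finite F" "F \<subseteq> K"
    show "K \<inter> (\<Inter>y\<in>F. {x. u y \<le> u x}) \<noteq> {}"
    proof (cases "F = {}")
      case False
      then have "Max (u ` F) \<in> u ` F"
        using F by (intro Max_in) auto
      then obtain x where "x \<in> F" "u x = Max (u ` F)"
        by force
      then show ?thesis
        using F by auto
    qed (use K in auto)
  qed
  then show ?thesis
    using that by blast
qed

lemma level_set_pos: "\<alpha> > 0 \<Longrightarrow> level_set u \<alpha> = {x. \<alpha> \<le> u x}"
  by (simp add: level_set_def)

text \<open>Only levels in (0,1] need checking: superlevel sets at other heights are everything or
  empty, level 0 is a closure, and every level contains level 1, which yields nonemptiness.\<close>

lemma fuzzy_setsI:
  fixes u :: "'a::metric_space \<Rightarrow> real"
  assumes UNIV: "compact (UNIV :: 'a set)" and range: "\<And>x. 0 \<le> u x" "\<And>x. u x \<le> 1"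
    and closed: "\<And>\<alpha>. \<alpha> \<in> {0<..1} \<Longrightarrow> closed (level_set u \<alpha>)" and "level_set u 1 \<noteq> {}"
  shows "u \<in> fuzzy_sets"
proof -
  have "closed {x. c \<le> u x}" for c
  proof -
    consider "c \<le> 0" | "c \<in> {0<..1}" | "c > 1"
      by force
    then show ?thesis
    proof cases
      case 1
      then have "{x. c \<le> u x} = UNIV"
        using range(1) order_trans by blast
      then show ?thesis by simp
    next
      case 2
      then show ?thesis
        using closed[of c] by (simp add: level_set_pos)
    next
      case 3
      then have "{x. c \<le> u x} = {}"
        using range(2) by (auto simp: not_le intro: le_less_trans)
      then show ?thesis by simp
    qed
  qed
  moreover have "level_set u \<alpha> \<in> nonempty_compacts" if "\<alpha> \<in> {0..1}" for \<alpha>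
  proof -
    obtain x where x: "1 \<le> u x"
      using assms(5) by (auto simp: level_set_pos)
    have "closed (level_set u \<alpha>)"
      using closed[of \<alpha>] that by (cases "\<alpha> = 0") (auto simp: level_set_def)
    moreover have "x \<in> level_set u \<alpha>"
      using that x closure_subset[of "{x. u x > 0}"] by (auto simp: level_set_def)
    ultimately show ?thesis
      using compact_if_closed[OF UNIV] by (auto simp: nonempty_compacts_def)
  qed
  ultimately show ?thesis
    using range by (auto simp: fuzzy_sets_def upper_semicontinuous_iff_closed)
qed

lemma fuzzy_setsD:
  assumes "u \<in> fuzzy_sets"
  shows "0 \<le> u x" "u x \<le> 1" "upper_semicontinuous u"
    and "\<alpha> \<in> {0<..1} \<Longrightarrow> compact (level_set u \<alpha>)" "\<alpha> \<in> {0<..1} \<Longrightarrow> level_set u \<alpha> \<noteq> {}"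
  using assms by (auto simp: fuzzy_sets_def nonempty_compacts_def image_subset_iff)

text \<open>A positive value \<open>u x\<close> is the largest height whose cut contains
  \<open>x\<close>; the value is 0 exactly when no positive cut does.\<close>

lemma fuzzy_sets_eqI:
  assumes u: "u \<in> fuzzy_sets" and v: "v \<in> fuzzy_sets"
    and eq: "\<And>\<alpha>. \<alpha> \<in> {0<..1} \<Longrightarrow> level_set u \<alpha> = level_set v \<alpha>"
  shows "u = v"
proof (rule ext)
  have *: "a x \<le> b x" if "a \<in> fuzzy_sets" "b \<in> fuzzy_sets"
    and "\<And>\<alpha>. \<alpha> \<in> {0<..1} \<Longrightarrow> level_set a \<alpha> = level_set b \<alpha>" for a b :: "'a \<Rightarrow> real" and x
  proof (cases "a x = 0")
    case False
    then have "a x \<in> {0<..1}"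
      using fuzzy_setsD(1,2)[OF that(1), of x] by auto
    with that(3)[OF this] show ?thesis
      by (auto simp: level_set_pos)
  qed (use fuzzy_setsD(1)[OF that(2)] in auto)
  show "u x = v x" for x
    using *[OF u v eq, of x] *[OF v u eq[symmetric], of x] by simp
qed

lemma hausdorff_dist_le_fuzzy_dist:
  fixes u v :: "'a::metric_space \<Rightarrow> real"
  assumes UNIV: "compact (UNIV :: 'a set)"
    and u: "u \<in> fuzzy_sets" and v: "v \<in> fuzzy_sets" and \<alpha>: "\<alpha> \<in> {0<..1}"
  shows "hausdorff_dist (level_set u \<alpha>) (level_set v \<alpha>) \<le> fuzzy_dist u v"
  unfolding fuzzy_dist_def
proof (rule cSUP_upper[OF \<alpha>])
  \<comment> \<open>A bound for all distances in the compact space bounds the Hausdorff distances of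
    all cuts at once.\<close>
  obtain e where e: "\<And>x y :: 'a. dist x y \<le> e"
    using compact_imp_bounded[OF UNIV] unfolding bounded_two_points by auto
  show "bdd_above ((\<lambda>\<alpha>. hausdorff_dist (level_set u \<alpha>) (level_set v \<alpha>)) ` {0<..1})"
  proof (rule bdd_aboveI2)
    fix \<beta> :: real assume "\<beta> \<in> {0<..1}"
    then have "level_set u \<beta> \<noteq> {}" "level_set v \<beta> \<noteq> {}"
      using fuzzy_setsD(5) u v by blast+
    then show "hausdorff_dist (level_set u \<beta>) (level_set v \<beta>) \<le> e"
      using e by (intro hausdorff_dist_leI) auto
  qed
qed

lemma fuzzy_dist_le:
  assumes "\<And>\<alpha>. \<alpha> \<in> {0<..1} \<Longrightarrow> hausdorff_dist (level_set u \<alpha>) (level_set v \<alpha>) \<le> r"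
  shows "fuzzy_dist u v \<le> r"
  unfolding fuzzy_dist_def using assms by (intro cSUP_least) auto

subsection \<open>Zadeh's extension\<close>

lemma zadeh_extension_eqI:
  assumes "f z = x" and "\<And>y. f y = x \<Longrightarrow> u y \<le> u z"
  shows "zadeh_extension f u x = u z"
proof -
  have "(SUP z\<in>f -` {x}. u z) = u z"
    using assms by (intro cSup_eq_maximum) auto
  then show ?thesis
    using assms(1) by (auto simp: zadeh_extension_def)
qed

text \<open>A nonempty fibre is closed, hence compact, so the upper semicontinuous \<open>u\<close>
  has a maximum on it.\<close>

lemma zadeh_extension_attained:
  fixes f :: "'a::metric_space \<Rightarrow> 'a"
  assumes UNIV: "compact (UNIV :: 'a set)" and cont: "continuous_on UNIV f"
    and u: "u \<in> fuzzy_sets" and "f -` {x} \<noteq> {}"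
  obtains z where "f z = x" "\<And>y. f y = x \<Longrightarrow> u y \<le> u z" "zadeh_extension f u x = u z"
proof -
  have "compact (f -` {x})"
    using cont by (intro compact_if_closed[OF UNIV] closed_vimage) auto
  then obtain z where "z \<in> f -` {x}" "\<And>y. y \<in> f -` {x} \<Longrightarrow> u y \<le> u z"
    using upper_semicontinuous_attains_max[OF fuzzy_setsD(3)[OF u]] assms(4) by blast
  then show ?thesis
    using that zadeh_extension_eqI[of f z x u] by auto
qed

text \<open>Because the supremum over a fibre is attained, it reaches \<alpha> exactly when some
  point of the fibre lies in the cut of \<open>u\<close>.\<close>

lemma level_set_zadeh_extension:
  fixes f :: "'a::metric_space \<Rightarrow> 'a"
  assumes UNIV: "compact (UNIV :: 'a set)" and cont: "continuous_on UNIV f"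
    and u: "u \<in> fuzzy_sets" and \<alpha>: "\<alpha> > 0"
  shows "level_set (zadeh_extension f u) \<alpha> = f ` level_set u \<alpha>"
proof (rule set_eqI)
  fix x
  show "x \<in> level_set (zadeh_extension f u) \<alpha> \<longleftrightarrow> x \<in> f ` level_set u \<alpha>"
  proof (cases "f -` {x} = {}")
    \<comment> \<open>Outside the range of \<open>f\<close> the default value 0 is below \<alpha>,
      so \<open>x\<close> belongs to neither side.\<close>
    case True
    then show ?thesis
      using \<alpha> by (auto simp: level_set_pos zadeh_extension_def)
  next
    case False
    obtain z where "f z = x" "\<And>y. f y = x \<Longrightarrow> u y \<le> u z" "zadeh_extension f u x = u z"
      using zadeh_extension_attained[OF UNIV cont u False] by blast
    then show ?thesis
      using \<alpha> by (force simp: level_set_pos)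
  qed
qed

lemma zadeh_extension_in_fuzzy_sets:
  fixes f :: "'a::metric_space \<Rightarrow> 'a"
  assumes UNIV: "compact (UNIV :: 'a set)" and cont: "continuous_on UNIV f"
    and u: "u \<in> fuzzy_sets"
  shows "zadeh_extension f u \<in> fuzzy_sets"
proof (rule fuzzy_setsI[OF UNIV])
  have "zadeh_extension f u x \<in> {0..1}" for x
  proof (cases "f -` {x} = {}")
    case False
    then show ?thesis
      using zadeh_extension_attained[OF UNIV cont u False] fuzzy_setsD(1,2)[OF u]
      by (metis atLeastAtMost_iff)
  qed (simp add: zadeh_extension_def)
  then show "0 \<le> zadeh_extension f u x" "zadeh_extension f u x \<le> 1" for x
    by auto
  show "closed (level_set (zadeh_extension f u) \<alpha>)" if "\<alpha> \<in> {0<..1}" for \<alpha>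
    using that fuzzy_setsD(4)[OF u that] continuous_on_subset[OF cont]
    by (auto simp: level_set_zadeh_extension[OF UNIV cont u]
        intro!: compact_imp_closed compact_continuous_image)
  show "level_set (zadeh_extension f u) 1 \<noteq> {}"
    using fuzzy_setsD(5)[OF u, of 1] by (simp add: level_set_zadeh_extension[OF UNIV cont u])
qed

lemma orbit_map_zadeh_extension:
  fixes f :: "nat \<Rightarrow> 'a::metric_space \<Rightarrow> 'a"
  assumes UNIV: "compact (UNIV :: 'a set)" and cont: "\<And>n. continuous_on UNIV (f n)"
    and u: "u \<in> fuzzy_sets"
  shows "orbit_map (\<lambda>n. zadeh_extension (f n)) k u \<in> fuzzy_sets"
    and "\<alpha> > 0 \<Longrightarrow> level_set (orbit_map (\<lambda>n. zadeh_extension (f n)) k u) \<alpha> =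
      orbit_map f k ` level_set u \<alpha>"
proof -
  \<comment> \<open>Membership comes first, for all \<open>k\<close>: the one-step cut formula
    applies only to iterates known to be fuzzy sets.\<close>
  show *: "orbit_map (\<lambda>n. zadeh_extension (f n)) k u \<in> fuzzy_sets" for k
    by (induction k) (simp_all add: u zadeh_extension_in_fuzzy_sets[OF UNIV cont])
  show "level_set (orbit_map (\<lambda>n. zadeh_extension (f n)) k u) \<alpha> = orbit_map f k ` level_set u \<alpha>"
    if "\<alpha> > 0"
    by (induction k)
      (simp_all add: level_set_zadeh_extension[OF UNIV cont *] that image_image)
qed

lemma level_set_indicator:
  "\<alpha> \<in> {0<..1} \<Longrightarrow> level_set (indicator S) \<alpha> = S"
  by (auto simp: level_set_pos indicator_def split: if_splits)

lemma indicator_in_fuzzy_sets: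
  fixes S :: "'a::metric_space set"
  assumes "compact (UNIV :: 'a set)" and "closed S" and "S \<noteq> {}"
  shows "indicator S \<in> fuzzy_sets"
  using assms by (intro fuzzy_setsI) (auto simp: level_set_indicator)

subsection \<open>Shadowing of fuzzy sets\<close>

text \<open>Let \<open>w z\<close> be the minimum over \<open>k < n\<close> of the maximum of
  \<open>u k\<close> on the closed \<epsilon>-ball about the orbit point, together with
  \<open>u n\<close> at the final point. As these maxima are attained, \<open>w z\<close> reaches
  \<alpha> exactly when \<open>z\<close> shadows the \<alpha>-cuts.\<close>

lemma ex_fuzzy_set_of_shadowing_sets:
  fixes f :: "nat \<Rightarrow> 'a::metric_space \<Rightarrow> 'a"
  assumes UNIV: "compact (UNIV :: 'a set)" and cont: "\<And>n. continuous_on UNIV (f n)"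
    and u: "\<And>k. k \<le> n \<Longrightarrow> u k \<in> fuzzy_sets" and "\<epsilon> \<ge> 0"
    and nonempty: "shadowing_set f \<epsilon> n (\<lambda>k. level_set (u k) 1) \<noteq> {}"
  obtains w where "w \<in> fuzzy_sets"
    and "\<And>\<alpha>. \<alpha> \<in> {0<..1} \<Longrightarrow> level_set w \<alpha> = shadowing_set f \<epsilon> n (\<lambda>k. level_set (u k) \<alpha>)"
proof -
  have "\<exists>y. y \<in> cball x \<epsilon> \<and> (\<forall>y'\<in>cball x \<epsilon>. u k y' \<le> u k y)" if "k < n" for k x
  proof -
    have "compact (cball x \<epsilon>)" "cball x \<epsilon> \<noteq> {}"
      using compact_if_closed[OF UNIV closed_cball] \<open>\<epsilon> \<ge> 0\<close> by auto
    moreover have "upper_semicontinuous (u k)"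
      using u[of k] that fuzzy_setsD(3) by auto
    ultimately show ?thesis
      by (metis upper_semicontinuous_attains_max)
  qed
  \<comment> \<open>\<open>m k x\<close> is a chosen maximiser of \<open>u k\<close> on the closed
    ball about \<open>x\<close>.\<close>
  then obtain m where m: "\<And>k x. k < n \<Longrightarrow> dist x (m k x) \<le> \<epsilon>"
    "\<And>k x y. k < n \<Longrightarrow> dist x y \<le> \<epsilon> \<Longrightarrow> u k y \<le> u k (m k x)"
    unfolding mem_cball Ball_def by metis
  \<comment> \<open>At time \<open>n\<close> no ball is used, matching the exact landing
    condition.\<close>
  define g where "g k z = (if k < n then u k (m k (orbit_map f k z)) else u n (orbit_map f n z))"
    for k z
  define w where "w z = (MIN k\<in>{..n}. g k z)" for z
  have le_w: "c \<le> w z \<longleftrightarrow> (\<forall>k<n. c \<le> g k z) \<and> c \<le> g n z" for c z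
    by (auto simp: w_def le_eq_less_or_eq[of _ n])
  have levels: "level_set w \<alpha> = shadowing_set f \<epsilon> n (\<lambda>k. level_set (u k) \<alpha>)"
    if "\<alpha> \<in> {0<..1}" for \<alpha>
  proof -
    have "\<alpha> \<le> g k z \<longleftrightarrow> (\<exists>y. \<alpha> \<le> u k y \<and> dist (orbit_map f k z) y \<le> \<epsilon>)" if "k < n" for k z
      using m that by (auto simp: g_def intro: order_trans)
    moreover have "\<alpha> \<le> g n z \<longleftrightarrow> \<alpha> \<le> u n (orbit_map f n z)" for z
      by (simp add: g_def)
    ultimately show ?thesis
      using that by (auto simp: level_set_pos shadowing_set_def le_w)
  qed
  have "w \<in> fuzzy_sets"
  proof (rule fuzzy_setsI[OF UNIV])
    show "0 \<le> w z" for z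
      using fuzzy_setsD(1)[OF u] by (simp add: le_w g_def)
    have "w z \<le> g n z" for z
      by (simp add: w_def)
    then show "w z \<le> 1" for z
      using fuzzy_setsD(2)[OF u[OF order_refl]] by (auto simp: g_def intro: order_trans)
    show "closed (level_set w \<alpha>)" if "\<alpha> \<in> {0<..1}" for \<alpha>
      unfolding levels[OF that] using fuzzy_setsD(4,5)[OF u that]
      by (intro closed_shadowing_set cont) auto
    show "level_set w 1 \<noteq> {}"
      using nonempty by (simp add: levels)
  qed
  with levels that show ?thesis
    by blast
qed

text \<open>The fuzzy distance dominates every cut, so one \<delta> serves all levels. The shadowing
  sets of the cuts assemble to a fuzzy set, and their uniform bound survives the supremum over
  levels.\<close>

lemma h_shadowing_fuzzy_sets:
  fixes f :: "nat \<Rightarrow> 'a::metric_space \<Rightarrow> 'a"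
  assumes UNIV: "compact (UNIV :: 'a set)" and cont: "\<And>n. continuous_on UNIV (f n)"
    and "h_shadowing UNIV dist f"
  shows "h_shadowing fuzzy_sets fuzzy_dist (\<lambda>n. zadeh_extension (f n))"
  unfolding h_shadowing_def
proof (intro allI impI)
  let ?F = "\<lambda>n. zadeh_extension (f n)"
  fix \<epsilon> :: real assume "\<epsilon> > 0"
  then obtain \<delta> where "\<delta> > 0" and shadow: "\<And>n x. finite_pseudo_orbit UNIV dist f \<delta> n x \<Longrightarrow>
      \<exists>z. (\<forall>k<n. dist (orbit_map f k z) (x k) < \<epsilon> / 2) \<and> orbit_map f n z = x n"
    using assms(3) unfolding h_shadowing_def by (metis half_gt_zero)
  have "\<exists>w\<in>fuzzy_sets. (\<forall>k<n. fuzzy_dist (orbit_map ?F k w) (u k) < \<epsilon>) \<and> orbit_map ?F n w = u n"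
    if po: "finite_pseudo_orbit fuzzy_sets fuzzy_dist ?F \<delta> n u" for n u
  proof -
    let ?A = "\<lambda>\<alpha> k. level_set (u k) \<alpha>"
    let ?Z = "\<lambda>\<alpha>. shadowing_set f (\<epsilon> / 2) n (?A \<alpha>)"
    have u: "u k \<in> fuzzy_sets" if "k \<le> n" for k
      using po that by (auto simp: finite_pseudo_orbit_def)
    have pseudo: "hausdorff_dist (f i ` ?A \<alpha> i) (?A \<alpha> (Suc i)) < \<delta>"
      if "i < n" and \<alpha>: "\<alpha> \<in> {0<..1}" for i \<alpha>
    proof -
      have "u i \<in> fuzzy_sets" "u (Suc i) \<in> fuzzy_sets"
        using u that by auto
      then have "hausdorff_dist (level_set (?F i (u i)) \<alpha>) (?A \<alpha> (Suc i))
          \<le> fuzzy_dist (?F i (u i)) (u (Suc i))"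
        using \<alpha> by (intro hausdorff_dist_le_fuzzy_dist zadeh_extension_in_fuzzy_sets UNIV cont)
      also have "\<dots> < \<delta>"
        using po \<open>i < n\<close> by (auto simp: finite_pseudo_orbit_def)
      finally show ?thesis
        using \<alpha> by (simp add: level_set_zadeh_extension[OF UNIV cont \<open>u i \<in> fuzzy_sets\<close>])
    qed
    have Z: "?Z \<alpha> \<noteq> {}" "\<And>k. k < n \<Longrightarrow> hausdorff_dist (orbit_map f k ` ?Z \<alpha>) (?A \<alpha> k) \<le> \<epsilon> / 2"
      "orbit_map f n ` ?Z \<alpha> = ?A \<alpha> n" if \<alpha>: "\<alpha> \<in> {0<..1}" for \<alpha>
      using shadowing_set_shadows[OF UNIV shadow, where A = "?A \<alpha>" and n = n]
        pseudo[OF _ \<alpha>] fuzzy_setsD(5)[OF u \<alpha>] by auto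
    obtain w where w: "w \<in> fuzzy_sets" and levels: "\<And>\<alpha>. \<alpha> \<in> {0<..1} \<Longrightarrow> level_set w \<alpha> = ?Z \<alpha>"
      using ex_fuzzy_set_of_shadowing_sets[OF UNIV cont u _ Z(1)] \<open>\<epsilon> > 0\<close>
      by auto
    note orbit = orbit_map_zadeh_extension[of f, OF UNIV cont w]
    have "fuzzy_dist (orbit_map ?F k w) (u k) \<le> \<epsilon> / 2" if "k < n" for k
      using Z(2) that by (intro fuzzy_dist_le) (simp add: orbit levels)
    \<comment> \<open>Exact landing holds on every positive cut, and these cuts determine the fuzzy
      set.\<close>
    moreover have "orbit_map ?F n w = u n"
      using Z(3) by (intro fuzzy_sets_eqI orbit(1) u) (simp_all add: orbit levels)
    ultimately show ?thesis
      using w \<open>\<epsilon> > 0\<close> by (intro bexI[of _ w]) fastforce+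
  qed
  with \<open>\<delta> > 0\<close> show "\<exists>\<delta>>0. \<forall>n u. finite_pseudo_orbit fuzzy_sets fuzzy_dist ?F \<delta> n u \<longrightarrow>
      (\<exists>w\<in>fuzzy_sets. (\<forall>k<n. fuzzy_dist (orbit_map ?F k w) (u k) < \<epsilon>) \<and> orbit_map ?F n w = u n)"
    by blast
qed

text \<open>Points are encoded as indicators of singletons. Any point \<open>z\<close> of the 1-cut
  of the shadowing fuzzy set then shadows the points.\<close>

lemma h_shadowing_if_fuzzy_sets:
  fixes f :: "nat \<Rightarrow> 'a::metric_space \<Rightarrow> 'a"
  assumes UNIV: "compact (UNIV :: 'a set)" and cont: "\<And>n. continuous_on UNIV (f n)"
    and "h_shadowing fuzzy_sets fuzzy_dist (\<lambda>n. zadeh_extension (f n))"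
  shows "h_shadowing UNIV dist f"
  unfolding h_shadowing_def
proof (intro allI impI)
  let ?F = "\<lambda>n. zadeh_extension (f n)"
  fix \<epsilon> :: real assume "\<epsilon> > 0"
  then obtain \<delta> where "\<delta> > 0" and shadow:
    "\<And>n u. finite_pseudo_orbit fuzzy_sets fuzzy_dist ?F \<delta> n u \<Longrightarrow>
      \<exists>w\<in>fuzzy_sets. (\<forall>k<n. fuzzy_dist (orbit_map ?F k w) (u k) < \<epsilon>) \<and> orbit_map ?F n w = u n"
    using assms(3) unfolding h_shadowing_def by metis
  have "\<exists>z\<in>UNIV. (\<forall>k<n. dist (orbit_map f k z) (x k) < \<epsilon>) \<and> orbit_map f n z = x n"
    if po: "finite_pseudo_orbit UNIV dist f \<delta> n x" for n x
  proof -
    let ?u = "\<lambda>k. indicator {x k} :: 'a \<Rightarrow> real"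
    have u: "?u k \<in> fuzzy_sets" for k
      by (intro indicator_in_fuzzy_sets UNIV) auto
    have "fuzzy_dist (?F i (?u i)) (?u (Suc i)) < \<delta>" if "i < n" for i
    proof -
      \<comment> \<open>At each positive level the two cuts are the singletons of
        \<open>f i (x i)\<close> and \<open>x (Suc i)\<close>.\<close>
      have "fuzzy_dist (?F i (?u i)) (?u (Suc i)) \<le> dist (f i (x i)) (x (Suc i))"
        by (intro fuzzy_dist_le)
          (simp add: level_set_zadeh_extension[OF UNIV cont u] level_set_indicator)
      also have "\<dots> < \<delta>"
        using po that by (auto simp: finite_pseudo_orbit_def)
      finally show ?thesis .
    qed
    then have "finite_pseudo_orbit fuzzy_sets fuzzy_dist ?F \<delta> n ?u"
      using u by (auto simp: finite_pseudo_orbit_def)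
    then obtain w where w: "w \<in> fuzzy_sets"
      and near: "\<And>k. k < n \<Longrightarrow> fuzzy_dist (orbit_map ?F k w) (?u k) < \<epsilon>"
      and hits: "orbit_map ?F n w = ?u n"
      using shadow by blast
    note orbit = orbit_map_zadeh_extension[of f, OF UNIV cont w]
    obtain z where z: "z \<in> level_set w 1"
      using fuzzy_setsD(5)[OF w, of 1] by auto
    have "dist (orbit_map f k z) (x k) < \<epsilon>" if "k < n" for k
    proof -
      have "hausdorff_dist (orbit_map f k ` level_set w 1) {x k} < \<epsilon>"
        using hausdorff_dist_le_fuzzy_dist[OF UNIV orbit(1)[of k] u[of k], of 1] near[OF that]
        by (simp add: orbit(2) level_set_indicator)
      from hausdorff_dist_lessD(1)[OF UNIV _ _ this] z show ?thesis
        by auto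
    qed
    moreover have "orbit_map f n ` level_set w 1 = {x n}"
      using orbit(2)[where k = n and \<alpha> = 1] by (simp add: hits level_set_indicator)
    ultimately show ?thesis
      using z by (intro bexI[of _ z]) auto
  qed
  with \<open>\<delta> > 0\<close> show "\<exists>\<delta>>0. \<forall>n x. finite_pseudo_orbit UNIV dist f \<delta> n x \<longrightarrow>
      (\<exists>z\<in>UNIV. (\<forall>k<n. dist (orbit_map f k z) (x k) < \<epsilon>) \<and> orbit_map f n z = x n)"
    by blast
qed

text \<open>Each induced system is compared with the base space, through which the two induced
  systems are then compared with each other.\<close>

theorem theorem4p4:
  fixes f :: "nat \<Rightarrow> 'a::metric_space \<Rightarrow> 'a"
  assumes "compact (UNIV :: 'a set)"
    and "\<And>n. continuous_on UNIV (f n)"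
  shows "(h_shadowing (UNIV :: 'a set) dist f \<longleftrightarrow>
          h_shadowing (nonempty_compacts :: 'a set set) hausdorff_dist (\<lambda>n. set_extension (f n))) \<and>
         (h_shadowing (nonempty_compacts :: 'a set set) hausdorff_dist (\<lambda>n. set_extension (f n)) \<longleftrightarrow>
          h_shadowing (fuzzy_sets :: ('a \<Rightarrow> real) set) fuzzy_dist (\<lambda>n. zadeh_extension (f n)))"
  using h_shadowing_nonempty_compacts[of f, OF assms] h_shadowing_if_nonempty_compacts[of f, OF assms(1)]
    h_shadowing_fuzzy_sets[of f, OF assms] h_shadowing_if_fuzzy_sets[of f, OF assms]
  by blast

end
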